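(* Let $(E,\mathcal{F},\tau)$ be a real locally convex space, $\psi:E\to\mathbb{R}$ a seminorm, $K, A\subseteq E$ nontrivial cones with normlike-bases $B_K$ and $B_A$ (with respect to $\psi$), and let $K$ be pointed. Define $S_{-K}:=\mathrm{conv}(-B_K)$ and $S_A^0:=\mathrm{conv}(B_A\cup\{0\})$. Consider the two assertions: $1^\circ$ $(\mathrm{cl}_\tau\,S_A^0)\cap(\mathrm{cl}_\tau\,S_{-K})=\emptyset$. $2^\circ$ There exists $(x^*,\alpha)\in K_\tau^{a\#}\cap(E^*\times\mathbb{P})$ such that $$x^*(a)+\alpha\psi(a)\ \geq\ 0\ \geq\ x^*(k)+\alpha\psi(k)\quad\text{for all } a\in A\text{ and }k\in -K,$$ $$x^*(a)+\alpha\psi(a)\ >\ 0\ >\ x^*(k)+\alpha\psi(k)\quad\text{for all } a\in A\setminus\{0\}\text{ and }k\in -K\setminus\{0\}.$$ If one of the sets $\mathrm{cl}_\tau\,S_{-K}$ and $\mathrm{cl}_\tau\,S_A^0$ is $\tau$-compact, then $1^\circ\Longrightarrow 2^\circ$. If either (a) $B_K$ is $\tau$-compact, or (b) $\mathrm{cl}_\tau\,S_{-K}$ is $\tau$-compact, $\psi$ is $\tau$-continuous (e.g., $\psi\in\mathcal{F}$), and $K$ is $\tau$-closed and convex, then $2^\circ\Longrightarrow 1^\circ$.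
   Context: $(E,\mathcal{F},\tau)$ denotes a real locally convex space $E\neq\{0\}$ whose topology $\tau$ is generated by a family $\mathcal{F}$ of seminorms (not assumed Hausdorff). $E'$ is the algebraic dual and $E^*=(E,\tau)^*$ the topological dual; $\mathbb{R}_+=[0,\infty)$, $\mathbb{P}=(0,\infty)$. A set $K\subseteq E$ is a cone if $0\in K=\mathbb{R}_+\cdot K$ (not necessarily convex); it is nontrivial if $\{0\}\neq K\neq E$, pointed if $K\cap(-K)=\{0\}$. A seminorm is a sublinear symmetric function $\psi:E\to\mathbb{R}$ (not assumed $\tau$-continuous unless stated). A nontrivial cone $K$ has a normlike-base (w.r.t. $\psi$) if $\psi(x)>0$ for all $x\in K\setminus\{0\}$; the normlike-base is then $B_K:=\{x\in K\mid \psi(x)=1\}$. All normlike-bases are taken with respect to the same fixed seminorm $\psi$. $\mathrm{cl}_\tau$ is $\tau$-closure, $\mathrm{conv}$ the convex hull; $\tau$-compact means every $\tau$-open cover has a finite subcover. $-K\setminus\{0\}$ means $(-K)\setminus\{0\}$. $K^\#:=\{y'\in E'\mid \forall k\in K\setminus\{0\}:\ y'(k)>0\}$, $K^{a\#}:=\{(x',\alpha)\in K^\#\times\mathbb{R}_+\mid \forall y\in K\setminus\{0\}:\ x'(y)-\alpha\psi(y)>0\}$, and $K_\tau^{a\#}:=K^{a\#}\cap(E^*\times\mathbb{R})$. *)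

theory Defs
  imports "HOL-Analysis.Analysis"
begin

text \<open>The space \<open>E\<close> is a type of class \<open>real_vector\<close>, with its topology given as an explicit value of
  type \<open>'a topology\<close>; it is not required to be Hausdorff.\<close>

definition seminorm :: "('a::real_vector \<Rightarrow> real) \<Rightarrow> bool" where
  "seminorm \<psi> \<longleftrightarrow>
     (\<forall>x y. \<psi> (x + y) \<le> \<psi> x + \<psi> y) \<and>
     (\<forall>c x. c \<ge> 0 \<longrightarrow> \<psi> (c *\<^sub>R x) = c * \<psi> x) \<and>
     (\<forall>x. \<psi> (- x) = \<psi> x)"

text \<open>The topology whose subbase consists of the open semiballs. The member \<open>UNIV\<close> only matters for
  \<open>F = {}\<close>, where \<open>topology_generated_by {}\<close> would have an empty carrier.\<close>

definition seminorm_topology :: "('a::real_vector \<Rightarrow> real) set \<Rightarrow> 'a topology" where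
  "seminorm_topology F =
     topology_generated_by (insert UNIV {{y. p (y - x) < e} | p x e. p \<in> F \<and> e > 0})"

lemma topspace_seminorm_topology [simp]: "topspace (seminorm_topology F) = UNIV"
  by (auto simp: seminorm_topology_def topology_generated_by_topspace)

definition alg_dual :: "('a::real_vector \<Rightarrow> real) set" where
  "alg_dual = {f. linear f}"

definition top_dual :: "'a::real_vector topology \<Rightarrow> ('a \<Rightarrow> real) set" where
  "top_dual \<tau> = {f. linear f \<and> continuous_map \<tau> euclideanreal f}"

text \<open>Unlike the library's \<open>cone\<close>, the empty set is excluded.\<close>

definition is_cone :: "'a::real_vector set \<Rightarrow> bool" where
  "is_cone K \<longleftrightarrow> 0 \<in> K \<and> K = {c *\<^sub>R x | c x. c \<ge> 0 \<and> x \<in> K}"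

lemma is_cone_iff: "is_cone K \<longleftrightarrow> 0 \<in> K \<and> cone K"
proof -
  have "K \<subseteq> {c *\<^sub>R x | c x. c \<ge> 0 \<and> x \<in> K}"
    by (force intro: exI[of _ 1])
  then show ?thesis
    by (auto simp: is_cone_def cone_def)
qed

definition nontrivial_cone :: "'a::real_vector set \<Rightarrow> bool" where
  "nontrivial_cone K \<longleftrightarrow> is_cone K \<and> K \<noteq> {0} \<and> K \<noteq> UNIV"

definition pointed :: "'a::real_vector set \<Rightarrow> bool" where
  "pointed K \<longleftrightarrow> K \<inter> uminus ` K = {0}"

definition has_normlike_base :: "('a::real_vector \<Rightarrow> real) \<Rightarrow> 'a set \<Rightarrow> bool" where
  "has_normlike_base \<psi> K \<longleftrightarrow> (\<forall>x \<in> K - {0}. \<psi> x > 0)"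

definition normlike_base :: "('a::real_vector \<Rightarrow> real) \<Rightarrow> 'a set \<Rightarrow> 'a set" where
  "normlike_base \<psi> K = {x \<in> K. \<psi> x = 1}"

text \<open>\<open>neg_base_hull \<psi> K\<close> is $S_{-K}$ and \<open>base_hull0 \<psi> A\<close> is $S_A^0$.\<close>

definition neg_base_hull :: "('a::real_vector \<Rightarrow> real) \<Rightarrow> 'a set \<Rightarrow> 'a set" where
  "neg_base_hull \<psi> K = convex hull (uminus ` normlike_base \<psi> K)"

definition base_hull0 :: "('a::real_vector \<Rightarrow> real) \<Rightarrow> 'a set \<Rightarrow> 'a set" where
  "base_hull0 \<psi> A = convex hull (normlike_base \<psi> A \<union> {0})"

text \<open>The sets $K^\#$, $K^{a\#}$ and $K_\tau^{a\#}$.\<close>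

definition dual_sharp :: "'a::real_vector set \<Rightarrow> ('a \<Rightarrow> real) set" where
  "dual_sharp K = {f \<in> alg_dual. \<forall>k \<in> K - {0}. f k > 0}"

definition aug_dual_sharp ::
    "('a::real_vector \<Rightarrow> real) \<Rightarrow> 'a set \<Rightarrow> (('a \<Rightarrow> real) \<times> real) set" where
  "aug_dual_sharp \<psi> K =
     {(f, \<alpha>) \<in> dual_sharp K \<times> {0..}. \<forall>y \<in> K - {0}. f y - \<alpha> * \<psi> y > 0}"

definition top_aug_dual_sharp ::
    "'a::real_vector topology \<Rightarrow> ('a \<Rightarrow> real) \<Rightarrow> 'a set \<Rightarrow> (('a \<Rightarrow> real) \<times> real) set" where
  "top_aug_dual_sharp \<tau> \<psi> K = aug_dual_sharp \<psi> K \<inter> (top_dual \<tau> \<times> UNIV)"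

end

theory Submission
  imports Defs
begin

text \<open>For \<open>1\<^sup>\<circ> \<Longrightarrow> 2\<^sup>\<circ>\<close>, compactness makes the two closed sets uniformly apart in a finite sum \<open>p\<close> of the
  generating seminorms, \<open>p (a - s) \<ge> e > 0\<close>, and a Hahn--Banach argument of Mazur--Orlicz type yields a linear
  \<open>f \<le> p\<close> with \<open>f (a - s) \<ge> e\<close>. Since \<open>0\<close> lies in $S_A^0$, a separating level can be chosen
  negative; its opposite is \<open>\<alpha>\<close>. For \<open>2\<^sup>\<circ> \<Longrightarrow> 1\<^sup>\<circ>\<close>, a compact $B_K$ makes the strict bound
  \<open>f < - \<alpha>\<close> on $-B_K$ uniform, so that it survives closed convex hulls. Case (b) reduces to case (a):
  $-B_K$ is then a closed subset of the compact set $\mathrm{cl}\,S_{-K}$.\<close>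

section \<open>Sublinear functionals and Hahn-Banach extension\<close>

definition sublinear :: "('a::real_vector \<Rightarrow> real) \<Rightarrow> bool" where
  "sublinear q \<longleftrightarrow>
     (\<forall>x y. q (x + y) \<le> q x + q y) \<and> (\<forall>c x. c \<ge> 0 \<longrightarrow> q (c *\<^sub>R x) = c * q x)"

lemma sublinear_add: "sublinear q \<Longrightarrow> q (x + y) \<le> q x + q y"
  and sublinear_scale: "sublinear q \<Longrightarrow> c \<ge> 0 \<Longrightarrow> q (c *\<^sub>R x) = c * q x"
  by (auto simp: sublinear_def)

lemma sublinear_0: "sublinear q \<Longrightarrow> q 0 = 0"
  using sublinear_scale[of q 0 0] by simp

lemma sublinear_minus_ge: "sublinear q \<Longrightarrow> - q (- x) \<le> q x"
  using sublinear_add[of q x "- x"] sublinear_0[of q] by simp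

text \<open>One inequality suffices for positive homogeneity: used again with \<open>1 / c\<close>
  at \<open>c *\<^sub>R x\<close>, it yields the reverse one. The factor \<open>0\<close> is covered
  by \<open>q 0 = 0\<close>.\<close>

lemma sublinearI:
  assumes add: "\<And>x y. q (x + y) \<le> q x + q y" and zero: "q 0 = 0"
    and scale: "\<And>c x. c > 0 \<Longrightarrow> q (c *\<^sub>R x) \<le> c * q x"
  shows "sublinear q"
proof -
  have "q (c *\<^sub>R x) = c * q x" if "c > 0" for c x
  proof (rule antisym[OF scale[OF that]])
    have "q x \<le> (1 / c) * q (c *\<^sub>R x)"
      using scale[of "1 / c" "c *\<^sub>R x"] that by simp
    then show "c * q x \<le> q (c *\<^sub>R x)"
      using that by (simp add: field_simps)
  qed
  then have "q (c *\<^sub>R x) = c * q x" if "c \<ge> 0" for c x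
    using that zero by (cases "c = 0") auto
  with add show ?thesis
    by (auto simp: sublinear_def)
qed

text \<open>Used twice: with \<open>D = {y}\<close> and \<open>e = q y\<close> it shows that a minimal sublinear functional is odd, hence
  linear; with general \<open>D\<close> it carries the separation into Hahn--Banach.\<close>

lemma sublinear_reduce:
  assumes q: "sublinear q" and D: "convex D" "D \<noteq> {}" and e: "\<And>d. d \<in> D \<Longrightarrow> e \<le> q d"
  obtains r where "sublinear r" "r \<le> q" "\<And>d. d \<in> D \<Longrightarrow> r (- d) \<le> - e"
proof -
  \<comment> \<open>The largest candidate: a sublinear \<open>s \<le> q\<close> with
    \<open>s (- d) \<le> - e\<close> on \<open>D\<close> satisfies \<open>s x \<le> s (x + t
    *\<^sub>R d) + t * s (- d) \<le> q (x + t *\<^sub>R d) - t * e\<close>.\<close>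
  define r where "r x = (INF (t, d)\<in>{0..} \<times> D. q (x + t *\<^sub>R d) - t * e)" for x
  have te: "t * e \<le> q (t *\<^sub>R d)" if "t \<ge> 0" "d \<in> D" for t d
    using that e sublinear_scale[OF q] by (simp add: mult_left_mono)
  \<comment> \<open>Here \<open>e \<le> q d\<close> enters: it gives a lower bound independent of
    \<open>t\<close> and \<open>d\<close>, so that the real infimum is genuine.\<close>
  have bound: "- q (- x) \<le> q (x + t *\<^sub>R d) - t * e" if "t \<ge> 0" "d \<in> D" for x t d
    using te[OF that] sublinear_add[OF q, of "x + t *\<^sub>R d" "- x"] by simp
  have lower: "r x \<le> q (x + t *\<^sub>R d) - t * e" if "t \<ge> 0" "d \<in> D" for x t d
    unfolding r_def
    using that bound by (intro cINF_lower2[of _ _ "(t, d)"] bdd_belowI2[of _ "- q (- x)"]) auto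
  have greatest: "z \<le> r x" if "\<And>t d. t \<ge> 0 \<Longrightarrow> d \<in> D \<Longrightarrow> z \<le> q (x + t *\<^sub>R d) - t * e" for x z
    unfolding r_def using that D(2) by (intro cINF_greatest) auto
  obtain d0 where d0: "d0 \<in> D"
    using D(2) by blast
  have le: "r x \<le> q x" for x
    using lower[of 0 d0 x] d0 by simp
  have "sublinear r"
  proof (rule sublinearI)
    fix x y
    have *: "r (x + y) \<le> (q (x + t *\<^sub>R d) - t * e) + (q (y + s *\<^sub>R d') - s * e)"
      if t: "t \<ge> 0" "d \<in> D" and s: "s \<ge> 0" "d' \<in> D" for t d s d'
    proof -
      \<comment> \<open>Convexity of \<open>D\<close> merges the two multiples into one with factor
        \<open>t + s\<close>; if \<open>t + s = 0\<close>, both terms vanish and any element of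
        \<open>D\<close> serves.\<close>
      obtain d'' where d'': "d'' \<in> D" "(t + s) *\<^sub>R d'' = t *\<^sub>R d + s *\<^sub>R d'"
      proof (cases "t + s = 0")
        case True
        then show ?thesis
          using t s that[of d] by (simp add: add_nonneg_eq_0_iff)
      next
        case False
        have "(t / (t + s)) *\<^sub>R d + (s / (t + s)) *\<^sub>R d' \<in> D"
          using t s False by (intro convexD[OF D(1)]) (auto simp: add_divide_distrib[symmetric])
        moreover have "(t + s) *\<^sub>R ((t / (t + s)) *\<^sub>R d + (s / (t + s)) *\<^sub>R d') = t *\<^sub>R d + s *\<^sub>R d'"
          using False by (simp add: scaleR_add_right)
        ultimately show ?thesis
          by (rule that)
      qed
      have "r (x + y) \<le> q ((x + y) + (t + s) *\<^sub>R d'') - (t + s) * e"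
        using t s d''(1) by (intro lower) auto
      also have "(x + y) + (t + s) *\<^sub>R d'' = (x + t *\<^sub>R d) + (y + s *\<^sub>R d')"
        by (simp add: d''(2))
      finally show ?thesis
        using sublinear_add[OF q, of "x + t *\<^sub>R d" "y + s *\<^sub>R d'"] by (simp add: algebra_simps)
    qed
    \<comment> \<open>The infima are taken one after the other: first over the pair belonging to
      \<open>y\<close>, then over the one belonging to \<open>x\<close>.\<close>
    have "r (x + y) - (q (x + t *\<^sub>R d) - t * e) \<le> r y" if "t \<ge> 0" "d \<in> D" for t d
      using *[OF that] by (intro greatest) (simp add: algebra_simps)
    then have "r (x + y) - r y \<le> r x"
      by (intro greatest) (simp add: algebra_simps)
    then show "r (x + y) \<le> r x + r y"
      by simp
  next
    show "r 0 = 0"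
      using le[of 0] sublinear_0[OF q] te by (intro antisym greatest) auto
  next
    fix c x assume c: "(c::real) > 0"
    have "r (c *\<^sub>R x) / c \<le> r x"
    proof (rule greatest)
      fix t d assume t: "(t::real) \<ge> 0" "d \<in> D"
      have "r (c *\<^sub>R x) \<le> q (c *\<^sub>R x + (c * t) *\<^sub>R d) - (c * t) * e"
        using c t by (intro lower) auto
      also have "c *\<^sub>R x + (c * t) *\<^sub>R d = c *\<^sub>R (x + t *\<^sub>R d)"
        by (simp add: scaleR_add_right)
      also have "q \<dots> = c * q (x + t *\<^sub>R d)"
        using c by (simp add: sublinear_scale[OF q])
      finally show "r (c *\<^sub>R x) / c \<le> q (x + t *\<^sub>R d) - t * e"
        using c by (simp add: field_simps)
    qed
    then show "r (c *\<^sub>R x) \<le> c * r x"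
      using c by (simp add: field_simps)
  qed
  moreover have "r \<le> q"
    using le by (simp add: le_fun_def)
  moreover have "r (- d) \<le> - e" if "d \<in> D" for d
    using lower[of 1 d "- d"] that sublinear_0[OF q] by simp
  ultimately show ?thesis
    by (rule that)
qed

lemma minimal_sublinear_linear:
  assumes f: "sublinear f" and min: "\<And>g. sublinear g \<Longrightarrow> g \<le> f \<Longrightarrow> g = f"
  shows "linear f"
proof -
  have minus: "f (- y) = - f y" for y
  proof -
    obtain g where "sublinear g" "g \<le> f" "g (- y) \<le> - f y"
      using sublinear_reduce[OF f, of "{y}" "f y"] by auto
    then have "f (- y) \<le> - f y"
      using min by blast
    then show ?thesis
      using sublinear_minus_ge[OF f, of y] by simp
  qed
  show ?thesis
  proof (rule linearI)
    fix x y
    \<comment> \<open>Subadditivity at the negatives turns into superadditivity at \<open>x\<close>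
      and \<open>y\<close>, because \<open>f\<close> is odd.\<close>
    have "f (- x + - y) \<le> f (- x) + f (- y)"
      by (rule sublinear_add[OF f])
    then have "- f (x + y) \<le> - f x - f y"
      using minus[of "x + y"] by (simp add: minus)
    then show "f (x + y) = f x + f y"
      using sublinear_add[OF f, of x y] by simp
  next
    fix c x
    show "f (c *\<^sub>R x) = c *\<^sub>R f x"
    proof (cases "c \<ge> 0")
      case False
      have "f (c *\<^sub>R x) = - f ((- c) *\<^sub>R x)"
        using minus[of "c *\<^sub>R x"] by simp
      with False show ?thesis
        by (subst (asm) sublinear_scale[OF f]) auto
    qed (simp add: sublinear_scale[OF f])
  qed
qed

text \<open>Supplies the lower bounds for Zorn's lemma. The common majorant \<open>q\<close> keeps
  the infimum finite, by \<open>- q (- x) \<le> - f (- x) \<le> f x\<close>. For subadditivity, two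
  members \<open>f\<close> and \<open>g\<close> are replaced by the smaller one, which is where the
  chain condition is used.\<close>

lemma sublinear_INF_chain:
  assumes C: "\<And>f. f \<in> C \<Longrightarrow> sublinear f" "C \<noteq> {}"
    and bound: "\<And>f x. f \<in> C \<Longrightarrow> f x \<le> q x"
    and chain: "\<And>f g. f \<in> C \<Longrightarrow> g \<in> C \<Longrightarrow> f \<le> g \<or> g \<le> f"
  shows "sublinear (\<lambda>x. INF f\<in>C. f x)" and "\<And>f. f \<in> C \<Longrightarrow> (INF f\<in>C. f x) \<le> f x"
proof -
  have "- q (- x) \<le> f x" if "f \<in> C" for f x
    using bound[OF that, of "- x"] sublinear_minus_ge[OF C(1)[OF that], of x] by simp
  then show lower: "(INF f\<in>C. f x) \<le> f x" if "f \<in> C" for f x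
    using that by (intro cINF_lower bdd_belowI2[of _ "- q (- x)"]) auto
  show "sublinear (\<lambda>x. INF f\<in>C. f x)"
  proof (rule sublinearI)
    fix x y
    have *: "(INF f\<in>C. f (x + y)) \<le> f x + g y" if fg: "f \<in> C" "g \<in> C" for f g
    proof -
      obtain h where h: "h \<in> C" "h \<le> f" "h \<le> g"
        using chain[OF fg] fg by blast
      have "(INF f\<in>C. f (x + y)) \<le> h x + h y"
        using lower[OF h(1), of "x + y"] sublinear_add[OF C(1)[OF h(1)], of x y] by linarith
      also have "\<dots> \<le> f x + g y"
        using h by (intro add_mono) (auto simp: le_fun_def)
      finally show ?thesis .
    qed
    have "(INF f\<in>C. f (x + y)) - f x \<le> (INF g\<in>C. g y)" if "f \<in> C" for f
      using *[OF that] C(2) by (intro cINF_greatest) (auto simp: algebra_simps)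
    then have "(INF f\<in>C. f (x + y)) - (INF g\<in>C. g y) \<le> (INF f\<in>C. f x)"
      using C(2) by (intro cINF_greatest) (auto simp: algebra_simps)
    then show "(INF f\<in>C. f (x + y)) \<le> (INF f\<in>C. f x) + (INF f\<in>C. f y)"
      by simp
  next
    have "(\<lambda>f. f 0) ` C = {0}"
      using C sublinear_0 by force
    then show "(INF f\<in>C. f 0) = 0"
      by simp
  next
    fix c x assume c: "(c::real) > 0"
    have "(INF f\<in>C. f (c *\<^sub>R x)) / c \<le> (INF f\<in>C. f x)"
    proof (rule cINF_greatest[OF C(2)])
      fix f assume "f \<in> C"
      then show "(INF f\<in>C. f (c *\<^sub>R x)) / c \<le> f x"
        using lower[of f "c *\<^sub>R x"] c sublinear_scale[OF C(1), of f c x] by (simp add: field_simps)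
    qed
    then show "(INF f\<in>C. f (c *\<^sub>R x)) \<le> c * (INF f\<in>C. f x)"
      using c by (simp add: field_simps)
  qed
qed

text \<open>Zorn's lemma for the reversed pointwise order yields a minimal sublinear functional
  below \<open>q\<close>, and minimal ones are linear.\<close>

lemma Hahn_Banach_sublinear:
  assumes q: "sublinear q"
  obtains f where "linear f" "f \<le> q"
proof -
  define S where "S = {f. sublinear f \<and> f \<le> q}"
  have "\<exists>m\<in>S. \<forall>a\<in>S. a \<le> m \<longrightarrow> a = m"
  proof (rule predicate_Zorn[of S "\<lambda>f g. g \<le> f"])
    show "partial_order_on S (relation_of (\<lambda>f g. g \<le> f) S)"
      by (rule partial_order_on_relation_ofI) auto
  next
    fix C assume C: "C \<in> Chains (relation_of (\<lambda>f g. g \<le> f) S)"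
    show "\<exists>u\<in>S. \<forall>a\<in>C. u \<le> a"
    proof (cases "C = {}")
      case True
      then show ?thesis
        using q by (auto simp: S_def)
    next
      case False
      define u where "u x = (INF f\<in>C. f x)" for x
      have CS: "C \<subseteq> S"
        by (rule Chains_relation_of[OF C])
      have chain: "f \<le> g \<or> g \<le> f" if "f \<in> C" "g \<in> C" for f g
        using C that by (auto simp: Chains_def relation_of_def)
      have *: "sublinear f" "f x \<le> q x" if "f \<in> C" for f x
        using CS that by (auto simp: S_def le_fun_def)
      have "sublinear u" "u \<le> f" if "f \<in> C" for f
        using sublinear_INF_chain[of C q] * False chain that
        unfolding u_def le_fun_def by blast+
      moreover obtain f0 where "f0 \<in> C" "f0 \<le> q"
        using False CS by (auto simp: S_def)
      ultimately have "u \<in> S"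
        unfolding S_def by (auto intro: order_trans)
      with \<open>\<And>f. f \<in> C \<Longrightarrow> u \<le> f\<close> show ?thesis
        by blast
    qed
  qed
  then obtain m where m: "m \<in> S" "\<And>a. a \<in> S \<Longrightarrow> a \<le> m \<Longrightarrow> a = m"
    by blast
  show ?thesis
  proof (rule that)
    show "m \<le> q"
      using m(1) by (simp add: S_def)
    show "linear m"
      using m by (intro minimal_sublinear_linear) (auto simp: S_def intro: order_trans)
  qed
qed

text \<open>The lower bound on \<open>D\<close> is first built into a smaller majorant
  \<open>r\<close>; every linear \<open>f \<le> r\<close> then has
  \<open>f d = - f (- d) \<ge> - r (- d) \<ge> e\<close>.\<close>

lemma Mazur_Orlicz:
  assumes "sublinear q" and "convex D" "D \<noteq> {}" and "\<And>d. d \<in> D \<Longrightarrow> e \<le> q d"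
  obtains f where "linear f" "f \<le> q" "\<And>d. d \<in> D \<Longrightarrow> e \<le> f d"
proof -
  obtain r where r: "sublinear r" "r \<le> q" "\<And>d. d \<in> D \<Longrightarrow> r (- d) \<le> - e"
    using sublinear_reduce[OF assms] by blast
  obtain f where f: "linear f" "f \<le> r"
    using Hahn_Banach_sublinear[OF r(1)] by blast
  have "e \<le> f d" if "d \<in> D" for d
    using f r(3)[OF that] le_funD[OF f(2), of "- d"] by (simp add: linear_neg)
  then show ?thesis
    using that f r(2) by (meson order_trans)
qed

section \<open>Seminorms and the topology that they generate\<close>

lemma seminorm_sublinear: "seminorm p \<Longrightarrow> sublinear p"
  by (auto simp: seminorm_def sublinear_def)

lemma seminorm_minus: "seminorm p \<Longrightarrow> p (- x) = p x"
  by (simp add: seminorm_def)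

lemma seminorm_minus_commute: "seminorm p \<Longrightarrow> p (x - y) = p (y - x)"
  using seminorm_minus[of p "x - y"] by simp

lemma seminorm_nonneg:
  assumes "seminorm p"
  shows "0 \<le> p x"
  using sublinear_minus_ge[OF seminorm_sublinear[OF assms], of x] seminorm_minus[OF assms, of x]
  by simp

lemma seminorm_triangle: "seminorm p \<Longrightarrow> p (x - z) \<le> p (x - y) + p (y - z)"
  using sublinear_add[OF seminorm_sublinear, of p "x - y" "y - z"] by simp

lemma seminorm_sum:
  assumes "\<And>p. p \<in> G \<Longrightarrow> seminorm p"
  shows "seminorm (\<lambda>x. \<Sum>p\<in>G. p x)"
  using assms
  by (auto simp: seminorm_def sum.distrib[symmetric] sum_distrib_left intro!: sum_mono sum.cong)

text \<open>For finite \<open>G\<close> these are the basic neighbourhoods of \<open>x\<close>. The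
  empty \<open>G\<close> gives the whole space, which also accommodates
  \<open>F = {}\<close>.\<close>

definition semiball :: "('a::real_vector \<Rightarrow> real) set \<Rightarrow> 'a \<Rightarrow> real \<Rightarrow> 'a set" where
  "semiball G x e = {y. \<forall>p\<in>G. p (y - x) < e}"

lemma semiball_self: "\<forall>p\<in>G. seminorm p \<Longrightarrow> e > 0 \<Longrightarrow> x \<in> semiball G x e"
  by (auto simp: semiball_def sublinear_0[OF seminorm_sublinear])

lemma openin_semiball:
  assumes "finite G" "G \<subseteq> F" "e > 0"
  shows "openin (seminorm_topology F) (semiball G x e)"
proof -
  have "openin (seminorm_topology F) {y. p (y - x) < e}" if "p \<in> G" for p
    using that assms unfolding seminorm_topology_def by (intro topology_generated_by_Basis) auto
  moreover have "semiball G x e = UNIV \<inter> (\<Inter>p\<in>G. {y. p (y - x) < e})"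
    by (auto simp: semiball_def)
  moreover have "openin (seminorm_topology F) UNIV"
    using openin_topspace[of "seminorm_topology F"] by simp
  ultimately show ?thesis
    using assms(1) by (cases "G = {}") (auto intro: openin_INT)
qed

text \<open>Induction on the generation of open sets. Subbasic semiballs are recentred at
  \<open>x\<close> by the triangle inequality; for intersections the families are united and the
  smaller radius is taken.\<close>

lemma openin_seminorm_topology_semiball:
  assumes F: "\<forall>p\<in>F. seminorm p" and U: "openin (seminorm_topology F) U" and "x \<in> U"
  obtains G e where "finite G" "G \<subseteq> F" "e > 0" "semiball G x e \<subseteq> U"
proof -
  have "generate_topology_on (insert UNIV {{y. p (y - x) < e} | p x e. p \<in> F \<and> e > 0}) U"
    using U by (simp add: seminorm_topology_def openin_topology_generated_by_iff)
  then have "\<forall>x\<in>U. \<exists>G e. finite G \<and> G \<subseteq> F \<and> e > 0 \<and> semiball G x e \<subseteq> U"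
  proof induction
    case Empty
    then show ?case by simp
  next
    case (Int U V)
    show ?case
    proof
      fix x assume x: "x \<in> U \<inter> V"
      obtain G e where G: "finite G" "G \<subseteq> F" "e > 0" "semiball G x e \<subseteq> U"
        using bspec[OF Int.IH(1) IntD1[OF x]] by (elim exE conjE)
      obtain H d where H: "finite H" "H \<subseteq> F" "d > 0" "semiball H x d \<subseteq> V"
        using bspec[OF Int.IH(2) IntD2[OF x]] by (elim exE conjE)
      have "semiball (G \<union> H) x (min e d) \<subseteq> semiball G x e \<inter> semiball H x d"
        by (auto simp: semiball_def)
      then have "finite (G \<union> H) \<and> G \<union> H \<subseteq> F \<and> min e d > 0 \<and> semiball (G \<union> H) x (min e d) \<subseteq> U \<inter> V"
        using G H by auto
      then show "\<exists>G e. finite G \<and> G \<subseteq> F \<and> e > 0 \<and> semiball G x e \<subseteq> U \<inter> V"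
        by blast
    qed
  next
    case (UN K)
    then show ?case
      by (meson Union_iff Union_upper order_trans)
  next
    case (Basis s)
    show ?case
    proof
      fix x assume x: "x \<in> s"
      consider "s = UNIV" | p z e where "p \<in> F" "e > 0" "s = {y. p (y - z) < e}"
        using Basis by auto
      then show "\<exists>G e. finite G \<and> G \<subseteq> F \<and> e > 0 \<and> semiball G x e \<subseteq> s"
      proof cases
        case 1
        then show ?thesis
          by (intro exI[of _ "{}"] exI[of _ 1]) auto
      next
        case 2
        \<comment> \<open>The new radius is what remains of \<open>e\<close> after the distance from
          \<open>x\<close> to the old centre \<open>z\<close>; it is positive since \<open>x\<close>
          lies in the semiball.\<close>
        have "p (y - z) < e" if "p (y - x) < e - p (x - z)" for y
          using that seminorm_triangle[of p y z x] F 2 by auto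
        then show ?thesis
          using 2 x by (intro exI[of _ "{p}"] exI[of _ "e - p (x - z)"]) (auto simp: semiball_def)
      qed
    qed
  qed
  with \<open>x \<in> U\<close> show ?thesis
    using that by blast
qed

lemma openin_seminorm_topologyI:
  assumes F: "\<forall>p\<in>F. seminorm p"
    and "\<And>x. x \<in> U \<Longrightarrow> \<exists>G e. finite G \<and> G \<subseteq> F \<and> e > 0 \<and> semiball G x e \<subseteq> U"
  shows "openin (seminorm_topology F) U"
proof (subst openin_subopen, rule ballI)
  fix x assume "x \<in> U"
  then obtain G e where G: "finite G" "G \<subseteq> F" "e > 0" "semiball G x e \<subseteq> U"
    using assms(2)[OF \<open>x \<in> U\<close>] by (elim exE conjE)
  then have "openin (seminorm_topology F) (semiball G x e)" "x \<in> semiball G x e"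
    using F by (auto intro!: openin_semiball semiball_self)
  with G(4) show "\<exists>T. openin (seminorm_topology F) T \<and> x \<in> T \<and> T \<subseteq> U"
    by blast
qed

text \<open>Seminorms are even, so negation maps semiballs to semiballs of the same radius. This
  later carries compactness from the side of \<open>- K\<close> to that of \<open>K\<close>.\<close>

lemma continuous_map_seminorm_uminus:
  assumes F: "\<forall>p\<in>F. seminorm p"
  shows "continuous_map (seminorm_topology F) (seminorm_topology F) uminus"
  unfolding continuous_map
proof (intro conjI allI impI)
  fix U assume U: "openin (seminorm_topology F) U"
  have "openin (seminorm_topology F) {x. - x \<in> U}"
  proof (rule openin_seminorm_topologyI[OF F])
    fix x assume "x \<in> {x. - x \<in> U}"
    then obtain G e where G: "finite G" "G \<subseteq> F" "e > 0" "semiball G (- x) e \<subseteq> U"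
      using openin_seminorm_topology_semiball[OF F U] by blast
    have "- y \<in> semiball G (- x) e" if "y \<in> semiball G x e" for y
      unfolding semiball_def mem_Collect_eq
    proof
      fix p assume p: "p \<in> G"
      then have "p (- y - - x) = p (y - x)"
        using F G(2) seminorm_minus_commute[of p x y] by auto
      also have "\<dots> < e"
        using p that by (simp add: semiball_def)
      finally show "p (- y - - x) < e" .
    qed
    with G show "\<exists>G e. finite G \<and> G \<subseteq> F \<and> e > 0 \<and> semiball G x e \<subseteq> {x. - x \<in> U}"
      by blast
  qed
  then show "openin (seminorm_topology F) {x \<in> topspace (seminorm_topology F). - x \<in> U}"
    by simp
qed auto

text \<open>The one-sided bound, applied to both \<open>y - x\<close> and \<open>x - y\<close>,
  controls the absolute value of \<open>f y - f x\<close>.\<close>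

lemma continuous_map_linear_le_sum:
  assumes F: "\<forall>p\<in>F. seminorm p" and G: "finite G" "G \<subseteq> F"
    and f: "linear f" "\<And>x. f x \<le> (\<Sum>p\<in>G. p x)"
  shows "continuous_map (seminorm_topology F) euclideanreal f"
  unfolding continuous_map
proof (intro conjI allI impI)
  fix U :: "real set" assume "openin euclideanreal U"
  then have U: "open U" by simp
  have "openin (seminorm_topology F) {x. f x \<in> U}"
  proof (rule openin_seminorm_topologyI[OF F])
    fix x assume "x \<in> {x. f x \<in> U}"
    then obtain e where e: "e > 0" "\<And>z. dist z (f x) < e \<Longrightarrow> z \<in> U"
      using U by (auto simp: open_dist)
    \<comment> \<open>Each of the \<open>card G\<close> summands is below \<open>d\<close>, so their
      sum stays below \<open>e\<close>; the added \<open>1\<close> avoids division by zero when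
      \<open>G\<close> is empty.\<close>
    define d where "d = e / (1 + card G)"
    have d: "d > 0" "card G * d < e"
      using e(1) by (simp_all add: d_def field_simps)
    have "f y \<in> U" if y: "y \<in> semiball G x d" for y
    proof (rule e(2))
      have le: "(\<Sum>p\<in>G. p (y - x)) \<le> card G * d"
        using y by (intro sum_bounded_above) (auto simp: semiball_def less_imp_le)
      have "f (y - x) \<le> (\<Sum>p\<in>G. p (y - x))" "f (x - y) \<le> (\<Sum>p\<in>G. p (x - y))"
        by (rule f(2))+
      moreover have "(\<Sum>p\<in>G. p (x - y)) = (\<Sum>p\<in>G. p (y - x))"
        using F G(2) by (intro sum.cong seminorm_minus_commute) auto
      ultimately show "dist (f y) (f x) < e"
        using le d(2) by (simp add: linear_diff[OF f(1)] dist_real_def)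
    qed
    with d(1) G show "\<exists>G e. finite G \<and> G \<subseteq> F \<and> e > 0 \<and> semiball G x e \<subseteq> {x. f x \<in> U}"
      by blast
  qed
  then show "openin (seminorm_topology F) {x \<in> topspace (seminorm_topology F). f x \<in> U}"
    by simp
qed auto

section \<open>Strict separation of convex sets\<close>

lemma compactin_closedin_apart:
  assumes F: "\<forall>p\<in>F. seminorm p" and C: "compactin (seminorm_topology F) C"
    and D: "closedin (seminorm_topology F) D" and disj: "C \<inter> D = {}"
  obtains G e where "finite G" "G \<subseteq> F" "e > 0"
    "\<And>c d. c \<in> C \<Longrightarrow> d \<in> D \<Longrightarrow> e \<le> (\<Sum>p\<in>G. p (d - c))"
proof -
  have open_compl: "openin (seminorm_topology F) (- D)"
    using D by (simp add: closedin_def Compl_eq_Diff_UNIV)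
  \<comment> \<open>The factor 2 leaves room for two steps of length at most \<open>e\<close>: from
    the centre \<open>c\<close> to a nearby \<open>x\<close> in \<open>C\<close>, and from
    \<open>x\<close> to \<open>y\<close>.\<close>
  have "\<exists>G e. finite G \<and> G \<subseteq> F \<and> e > 0 \<and> semiball G c (2 * e) \<subseteq> - D" if "c \<in> C" for c
  proof -
    have "c \<in> - D"
      using that disj by blast
    then obtain G e where "finite G" "G \<subseteq> F" "e > 0" "semiball G c e \<subseteq> - D"
      using openin_seminorm_topology_semiball[OF F open_compl] by blast
    then show ?thesis
      by (intro exI[of _ G] exI[of _ "e / 2"]) auto
  qed
  then obtain G e where Ge: "\<And>c. c \<in> C \<Longrightarrow> finite (G c) \<and> G c \<subseteq> F \<and> e c > 0 \<and> semiball (G c) c (2 * e c) \<subseteq> - D"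
    by metis
  have cover: "openin (seminorm_topology F) U" if "U \<in> (\<lambda>c. semiball (G c) c (e c)) ` C" for U
    using that Ge by (auto intro: openin_semiball)
  have "c \<in> semiball (G c) c (e c)" if "c \<in> C" for c
    using Ge[OF that] F by (intro semiball_self) auto
  then have "C \<subseteq> \<Union> ((\<lambda>c. semiball (G c) c (e c)) ` C)"
    by (intro subsetI UN_I)
  then obtain \<F> where \<F>: "finite \<F>" "\<F> \<subseteq> (\<lambda>c. semiball (G c) c (e c)) ` C" "C \<subseteq> \<Union>\<F>"
    using compactinD[OF C cover] by meson
  then obtain N where N: "finite N" "N \<subseteq> C" "C \<subseteq> (\<Union>c\<in>N. semiball (G c) c (e c))"
    using finite_subset_image[OF \<F>(1,2)] by blast
  define H where "H = (\<Union>c\<in>N. G c)"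
  \<comment> \<open>The inserted \<open>1\<close> keeps the minimum defined when \<open>N\<close>,
    and hence \<open>C\<close>, is empty.\<close>
  define d where "d = Min (insert 1 (e ` N))"
  have H: "finite H" "H \<subseteq> F"
    using N Ge unfolding H_def by blast+
  have d: "d > 0" "\<And>c. c \<in> N \<Longrightarrow> d \<le> e c"
    using N Ge by (auto simp: d_def)
  have "d \<le> (\<Sum>p\<in>H. p (y - x))" if x: "x \<in> C" and y: "y \<in> D" for x y
  proof (rule ccontr)
    assume less: "\<not> d \<le> (\<Sum>p\<in>H. p (y - x))"
    obtain c where c: "c \<in> N" "x \<in> semiball (G c) c (e c)"
      using N(3) x by blast
    have "p (y - c) < 2 * e c" if p: "p \<in> G c" for p
    proof -
      have pH: "p \<in> H"
        using p c(1) by (auto simp: H_def)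
      then have pF: "seminorm p"
        using H F by blast
      have "p (y - x) \<le> (\<Sum>p\<in>H. p (y - x))"
        using pH H F by (intro member_le_sum[where f = "\<lambda>p. p (y - x)"]) (auto intro: seminorm_nonneg)
      moreover have "p (x - c) < e c"
        using c(2) p by (auto simp: semiball_def)
      ultimately show ?thesis
        using less d(2)[OF c(1)] seminorm_triangle[OF pF, of y c x] by linarith
    qed
    then have "y \<in> semiball (G c) c (2 * e c)"
      by (simp add: semiball_def)
    then show False
      using Ge c(1) N(2) y by blast
  qed
  with H d(1) show ?thesis
    using that by blast
qed

text \<open>The difference set of \<open>T\<close> and \<open>S\<close> is convex, and a finite sum
  of generating seminorms is at least \<open>e\<close> on it. The functional dominated by that sum
  is continuous and keeps the gap \<open>e\<close>.\<close>

lemma strict_separation: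
  assumes F: "\<forall>p\<in>F. seminorm p" and S: "convex S" "S \<noteq> {}" and T: "convex T" "T \<noteq> {}"
    and cpt: "compactin (seminorm_topology F) (seminorm_topology F closure_of S) \<or>
      compactin (seminorm_topology F) (seminorm_topology F closure_of T)"
    and disj: "(seminorm_topology F closure_of S) \<inter> (seminorm_topology F closure_of T) = {}"
  obtains f b c where "f \<in> top_dual (seminorm_topology F)" "b < c"
    "\<And>x. x \<in> S \<Longrightarrow> f x \<le> b" "\<And>y. y \<in> T \<Longrightarrow> c \<le> f y"
proof -
  let ?t = "seminorm_topology F"
  obtain G e where G: "finite G" "G \<subseteq> F" and e: "e > 0"
    and ge: "\<And>x y. x \<in> ?t closure_of S \<Longrightarrow> y \<in> ?t closure_of T \<Longrightarrow> e \<le> (\<Sum>p\<in>G. p (y - x))"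
    using cpt
  proof
    assume "compactin ?t (?t closure_of S)"
    then show thesis
      by (rule compactin_closedin_apart[OF F _ closedin_closure_of disj]) (rule that)
  next
    assume cptT: "compactin ?t (?t closure_of T)"
    have disj': "(?t closure_of T) \<inter> (?t closure_of S) = {}"
      using disj by (simp add: Int_commute)
    obtain G e where G: "finite G" "G \<subseteq> F" "e > 0"
      and ge: "\<And>x y. x \<in> ?t closure_of S \<Longrightarrow> y \<in> ?t closure_of T \<Longrightarrow> e \<le> (\<Sum>p\<in>G. p (x - y))"
      by (rule compactin_closedin_apart[OF F cptT closedin_closure_of disj']) blast
    have "(\<Sum>p\<in>G. p (x - y)) = (\<Sum>p\<in>G. p (y - x))" for x y
      using F G(2) by (intro sum.cong seminorm_minus_commute) auto
    then show thesis
      using that[OF G] ge by simp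
  qed
  have sub: "S \<subseteq> ?t closure_of S" "T \<subseteq> ?t closure_of T"
    by (simp_all add: closure_of_subset)
  have sublin: "sublinear (\<lambda>x. \<Sum>p\<in>G. p x)"
    using F G(2) by (intro seminorm_sublinear seminorm_sum) auto
  have ne: "(\<Union>y\<in>T. \<Union>x\<in>S. {y - x}) \<noteq> {}"
    using S(2) T(2) by simp
  have "e \<le> (\<Sum>p\<in>G. p d)" if d: "d \<in> (\<Union>y\<in>T. \<Union>x\<in>S. {y - x})" for d
  proof -
    obtain x y where "x \<in> S" "y \<in> T" and d: "d = y - x"
      using d by blast
    with sub have "x \<in> ?t closure_of S" "y \<in> ?t closure_of T"
      by blast+
    then show ?thesis
      unfolding d by (rule ge)
  qed
  then obtain f where f: "linear f" "f \<le> (\<lambda>x. \<Sum>p\<in>G. p x)"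
    "\<And>d. d \<in> (\<Union>y\<in>T. \<Union>x\<in>S. {y - x}) \<Longrightarrow> e \<le> f d"
    by (rule Mazur_Orlicz[OF sublin convex_differences[OF T(1) S(1)] ne]) (assumption, blast)
  have sep: "f x + e \<le> f y" if "x \<in> S" "y \<in> T" for x y
  proof -
    have "e \<le> f (y - x)"
      using that by (intro f(3)) blast
    then show ?thesis
      by (simp add: linear_diff[OF f(1)])
  qed
  obtain y0 where y0: "y0 \<in> T"
    using T(2) by blast
  \<comment> \<open>A single point of \<open>T\<close> bounds \<open>f\<close> above on
    \<open>S\<close>, so the supremum is genuine; it becomes \<open>b\<close>, and \<open>c\<close>
    lies \<open>e\<close> above it.\<close>
  have bdd: "bdd_above (f ` S)"
    using sep[OF _ y0] by (intro bdd_aboveI2[of _ _ "f y0 - e"]) (simp add: algebra_simps)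
  show ?thesis
  proof (rule that)
    show "f \<in> top_dual ?t"
      using f continuous_map_linear_le_sum[OF F G f(1)] by (auto simp: top_dual_def le_fun_def)
    show "(SUP x\<in>S. f x) < (SUP x\<in>S. f x) + e"
      using e by simp
    show "f x \<le> (SUP x\<in>S. f x)" if "x \<in> S" for x
      using bdd that by (intro cSUP_upper)
    show "(SUP x\<in>S. f x) + e \<le> f y" if "y \<in> T" for y
    proof -
      have "(SUP x\<in>S. f x) \<le> f y - e"
        using sep[OF _ that] S(2) by (intro cSUP_least) (auto simp: algebra_simps)
      then show ?thesis by simp
    qed
  qed
qed

section \<open>Normlike-bases and their closed convex hulls\<close>

lemma normlike_base_scale:
  assumes "seminorm \<psi>" "is_cone K" "has_normlike_base \<psi> K" "x \<in> K - {0}"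
  obtains c b where "c > 0" "b \<in> normlike_base \<psi> K" "x = c *\<^sub>R b" "\<psi> x = c"
proof -
  have pos: "\<psi> x > 0"
    using assms by (auto simp: has_normlike_base_def)
  have "(1 / \<psi> x) *\<^sub>R x \<in> K"
    using assms(2,4) pos by (auto simp: is_cone_iff cone_def)
  moreover have "\<psi> ((1 / \<psi> x) *\<^sub>R x) = 1"
    using pos by (subst sublinear_scale[OF seminorm_sublinear[OF assms(1)]]) auto
  ultimately show ?thesis
    using pos by (intro that[of "\<psi> x" "(1 / \<psi> x) *\<^sub>R x"]) (auto simp: normlike_base_def)
qed

lemma normlike_base_nonempty:
  assumes "seminorm \<psi>" "nontrivial_cone K" "has_normlike_base \<psi> K"
  shows "normlike_base \<psi> K \<noteq> {}"
proof -
  obtain x where "x \<in> K - {0}"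
    using assms(2) by (auto simp: nontrivial_cone_def is_cone_def)
  then show ?thesis
    using normlike_base_scale[OF assms(1) _ assms(3)] assms(2) by (force simp: nontrivial_cone_def)
qed

text \<open>The half-space \<open>f x \<le> c\<close> is both convex and closed, so a bound on
  \<open>B\<close> passes to the closed convex hull.\<close>

lemma closure_of_hull_le:
  assumes f: "f \<in> top_dual \<tau>" and le: "\<And>x. x \<in> B \<Longrightarrow> f x \<le> c"
    and x: "x \<in> \<tau> closure_of (convex hull B)"
  shows "f x \<le> c"
proof -
  have "convex {x. f x \<le> c}"
    using convex_linear_vimage[of f "{..c}"] f by (simp add: vimage_def top_dual_def)
  then have "convex hull B \<subseteq> {x. f x \<le> c}"
    using le by (intro hull_minimal) auto
  moreover have "closedin \<tau> {x \<in> topspace \<tau>. f x \<in> {..c}}"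
    using f by (intro closedin_continuous_map_preimage) (auto simp: top_dual_def)
  \<comment> \<open>For a general \<open>\<tau>\<close> the hull may leave
    \<open>topspace \<tau>\<close>; intersecting it with the carrier does not change its
    closure.\<close>
  ultimately have "\<tau> closure_of (convex hull B) \<subseteq> {x \<in> topspace \<tau>. f x \<in> {..c}}"
    using closure_of_minimal[of "(convex hull B) \<inter> topspace \<tau>" "{x \<in> topspace \<tau>. f x \<in> {..c}}" \<tau>]
    by (auto simp: closure_of_restrict[of \<tau> "convex hull B"] Int_commute)
  then show ?thesis
    using x by auto
qed

lemma uminus_top_dual: "f \<in> top_dual \<tau> \<Longrightarrow> (\<lambda>x. - f x) \<in> top_dual \<tau>"
  by (auto simp: top_dual_def linear_compose_neg continuous_map_minus)

text \<open>The base is closed, being the part of \<open>K\<close> on the level set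
  \<open>\<psi> x = 1\<close>, and it lies in the negative of a compact set. Closed subsets of
  compact sets are compact without any Hausdorff assumption.\<close>

lemma compactin_normlike_base:
  assumes F: "\<forall>p\<in>F. seminorm p"
    and cpt: "compactin (seminorm_topology F) (seminorm_topology F closure_of neg_base_hull \<psi> K)"
    and \<psi>: "continuous_map (seminorm_topology F) euclideanreal \<psi>"
    and K: "closedin (seminorm_topology F) K"
  shows "compactin (seminorm_topology F) (normlike_base \<psi> K)"
proof -
  let ?t = "seminorm_topology F"
  have "closedin ?t {x \<in> topspace ?t. \<psi> x \<in> {1}}"
    using \<psi> by (intro closedin_continuous_map_preimage) auto
  moreover have "normlike_base \<psi> K = K \<inter> {x \<in> topspace ?t. \<psi> x \<in> {1}}"
    by (auto simp: normlike_base_def)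
  ultimately have closed: "closedin ?t (normlike_base \<psi> K)"
    using K by (simp add: closedin_Int)
  have "uminus ` normlike_base \<psi> K \<subseteq> ?t closure_of neg_base_hull \<psi> K"
    unfolding neg_base_hull_def using closure_of_subset[of _ ?t] hull_subset by fastforce
  then have "normlike_base \<psi> K \<subseteq> uminus ` (?t closure_of neg_base_hull \<psi> K)"
    by (force simp: image_subset_iff image_iff)
  with closed show ?thesis
    using image_compactin[OF cpt continuous_map_seminorm_uminus[OF F]]
    by (blast intro: closed_compactin)
qed

section \<open>From disjoint closures to a separating pair and back\<close>

lemma separating_pair_of_disjoint_closures:
  assumes F: "\<forall>p\<in>F. seminorm p" and \<psi>: "seminorm \<psi>"
    and K: "nontrivial_cone K" "has_normlike_base \<psi> K"
    and A: "nontrivial_cone A" "has_normlike_base \<psi> A"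
    and cpt: "compactin (seminorm_topology F) (seminorm_topology F closure_of neg_base_hull \<psi> K) \<or>
      compactin (seminorm_topology F) (seminorm_topology F closure_of base_hull0 \<psi> A)"
    and disj: "(seminorm_topology F closure_of base_hull0 \<psi> A) \<inter>
      (seminorm_topology F closure_of neg_base_hull \<psi> K) = {}"
  obtains f \<alpha> where "f \<in> top_dual (seminorm_topology F)" "\<alpha> > 0"
    "\<And>a. a \<in> A - {0} \<Longrightarrow> f a + \<alpha> * \<psi> a > 0" "\<And>y. y \<in> K - {0} \<Longrightarrow> f y - \<alpha> * \<psi> y > 0"
proof -
  have ne: "neg_base_hull \<psi> K \<noteq> {}"
    using normlike_base_nonempty[OF \<psi> K] by (simp add: neg_base_hull_def)
  have zero: "0 \<in> base_hull0 \<psi> A"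
    by (simp add: base_hull0_def hull_inc)
  have convex: "convex (neg_base_hull \<psi> K)" "convex (base_hull0 \<psi> A)"
    by (simp_all add: neg_base_hull_def base_hull0_def)
  have disj': "(seminorm_topology F closure_of neg_base_hull \<psi> K) \<inter>
      (seminorm_topology F closure_of base_hull0 \<psi> A) = {}"
    using disj by (simp add: Int_commute)
  have ne': "base_hull0 \<psi> A \<noteq> {}"
    using zero by blast
  obtain f b c where f: "f \<in> top_dual (seminorm_topology F)" and bc: "b < c"
    and sep: "\<And>x. x \<in> neg_base_hull \<psi> K \<Longrightarrow> f x \<le> b" "\<And>y. y \<in> base_hull0 \<psi> A \<Longrightarrow> c \<le> f y"
    by (rule strict_separation[OF F convex(1) ne convex(2) ne' cpt disj']) blast
  have lin: "linear f"
    using f by (simp add: top_dual_def)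
  have "c \<le> 0"
    using sep(2)[OF zero] lin by (simp add: linear_0)
  \<comment> \<open>The level \<open>- \<alpha>\<close> is the midpoint of \<open>b\<close> and
    \<open>c\<close>, so it is strict on both sides; it is negative because
    \<open>b < c \<le> 0\<close>.\<close>
  define \<alpha> where "\<alpha> = - (b + c) / 2"
  have \<alpha>: "\<alpha> > 0" "b < - \<alpha>" "- \<alpha> < c"
    using bc \<open>c \<le> 0\<close> by (simp_all add: \<alpha>_def field_simps)
  show ?thesis
  proof (rule that[OF f \<alpha>(1)])
    fix a assume "a \<in> A - {0}"
    then obtain t d where t: "t > 0" "d \<in> normlike_base \<psi> A" "a = t *\<^sub>R d" "\<psi> a = t"
      using normlike_base_scale[OF \<psi> _ A(2)] A(1) by (auto simp: nontrivial_cone_def)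
    have "c \<le> f d"
      using t(2) by (intro sep(2)) (simp add: base_hull0_def hull_inc)
    \<comment> \<open>As \<open>\<psi> d = 1\<close>, the bracket is the value of
      \<open>f + \<alpha> \<psi>\<close> at \<open>d\<close>; positive homogeneity carries its sign
      to \<open>a\<close>.\<close>
    then have "0 < t * (f d + \<alpha>)"
      using \<alpha> t(1) by simp
    also have "\<dots> = f a + \<alpha> * \<psi> a"
      using t(3,4) linear_scale[OF lin] by (simp add: algebra_simps)
    finally show "f a + \<alpha> * \<psi> a > 0" .
  next
    fix y assume "y \<in> K - {0}"
    then obtain t d where t: "t > 0" "d \<in> normlike_base \<psi> K" "y = t *\<^sub>R d" "\<psi> y = t"
      using normlike_base_scale[OF \<psi> _ K(2)] K(1) by (auto simp: nontrivial_cone_def)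
    have "f (- d) \<le> b"
      using t(2) by (intro sep(1)) (simp add: neg_base_hull_def hull_inc)
    then have "0 < t * (f d - \<alpha>)"
      using \<alpha> t(1) lin by (simp add: linear_neg)
    also have "\<dots> = f y - \<alpha> * \<psi> y"
      using t(3,4) linear_scale[OF lin] by (simp add: algebra_simps)
    finally show "f y - \<alpha> * \<psi> y > 0" .
  qed
qed

lemma disjoint_closures_of_separating_pair:
  assumes f: "f \<in> top_dual \<tau>" and "\<alpha> > 0"
    and fA: "\<And>a. a \<in> normlike_base \<psi> A \<Longrightarrow> f a + \<alpha> \<ge> 0"
    and fK: "\<And>y. y \<in> normlike_base \<psi> K \<Longrightarrow> f y - \<alpha> > 0"
    and cpt: "compactin \<tau> (normlike_base \<psi> K)" and ne: "normlike_base \<psi> K \<noteq> {}"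
  shows "(\<tau> closure_of base_hull0 \<psi> A) \<inter> (\<tau> closure_of neg_base_hull \<psi> K) = {}"
proof -
  have lin: "linear f" and cont: "continuous_map \<tau> euclideanreal f"
    using f by (auto simp: top_dual_def)
  have "compact (f ` normlike_base \<psi> K)"
    using image_compactin[OF cpt cont] by simp
  \<comment> \<open>The minimum of \<open>f\<close> on the compact base is attained and exceeds
    \<open>\<alpha>\<close>; one closure then lies in \<open>f x \<le> - f y < - \<alpha>\<close>,
    the other in \<open>f x \<ge> - \<alpha>\<close>.\<close>
  then obtain y where y: "y \<in> normlike_base \<psi> K" "\<And>z. z \<in> normlike_base \<psi> K \<Longrightarrow> f y \<le> f z"
    using compact_attains_inf[of "f ` normlike_base \<psi> K"] ne by auto
  have "f x \<le> - f y" if "x \<in> \<tau> closure_of neg_base_hull \<psi> K" for x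
  proof (rule closure_of_hull_le[OF f])
    show "x \<in> \<tau> closure_of (convex hull (uminus ` normlike_base \<psi> K))"
      using that by (simp add: neg_base_hull_def)
    show "f z \<le> - f y" if "z \<in> uminus ` normlike_base \<psi> K" for z
      using that y(2) by (auto simp: linear_neg[OF lin])
  qed
  moreover have "- f x \<le> \<alpha>" if "x \<in> \<tau> closure_of base_hull0 \<psi> A" for x
  proof (rule closure_of_hull_le[OF uminus_top_dual[OF f]])
    show "x \<in> \<tau> closure_of (convex hull (normlike_base \<psi> A \<union> {0}))"
      using that by (simp add: base_hull0_def)
    \<comment> \<open>The extra point \<open>0\<close> satisfies the bound because
      \<open>\<alpha>\<close> is positive.\<close>
    show "- f z \<le> \<alpha>" if "z \<in> normlike_base \<psi> A \<union> {0}" for z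
      using that fA[of z] linear_0[OF lin] \<open>\<alpha> > 0\<close> by auto
  qed
  ultimately show ?thesis
    using fK[OF y(1)] by (meson disjoint_iff le_minus_iff minus_le_iff not_less order_trans diff_gt_0_iff_gt)
qed

theorem theorem5p13:
  fixes F :: "('a::real_vector \<Rightarrow> real) set"
    and \<tau> :: "'a topology"
    and \<psi> :: "'a \<Rightarrow> real"
    and K A :: "'a set"
    and assertion1 assertion2 :: bool
  assumes "(UNIV :: 'a set) \<noteq> {0}"
    and "\<forall>p \<in> F. seminorm p" and "\<tau> = seminorm_topology F"
    and "seminorm \<psi>"
    and "nontrivial_cone K" and "has_normlike_base \<psi> K"
    and "nontrivial_cone A" and "has_normlike_base \<psi> A"
    and "pointed K"
  defines "assertion1 \<equiv>
      (\<tau> closure_of base_hull0 \<psi> A) \<inter> (\<tau> closure_of neg_base_hull \<psi> K) = {}"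
    and "assertion2 \<equiv>
      \<exists>(x, \<alpha>) \<in> top_aug_dual_sharp \<tau> \<psi> K \<inter> (top_dual \<tau> \<times> {0<..}).
        (\<forall>a \<in> A. \<forall>k \<in> uminus ` K.
           x a + \<alpha> * \<psi> a \<ge> 0 \<and> 0 \<ge> x k + \<alpha> * \<psi> k) \<and>
        (\<forall>a \<in> A - {0}. \<forall>k \<in> uminus ` K - {0}.
           x a + \<alpha> * \<psi> a > 0 \<and> 0 > x k + \<alpha> * \<psi> k)"
  shows "(compactin \<tau> (\<tau> closure_of neg_base_hull \<psi> K) \<or>
          compactin \<tau> (\<tau> closure_of base_hull0 \<psi> A) \<longrightarrow>
            (assertion1 \<longrightarrow> assertion2)) \<and>
         (compactin \<tau> (normlike_base \<psi> K) \<or>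
          (compactin \<tau> (\<tau> closure_of neg_base_hull \<psi> K) \<and>
           continuous_map \<tau> euclideanreal \<psi> \<and> closedin \<tau> K \<and> convex K) \<longrightarrow>
            (assertion2 \<longrightarrow> assertion1))"
proof -
  note F = assms(2) and \<tau> = assms(3) and \<psi> = assms(4) and K = assms(5,6) and A = assms(7,8)
  have cone: "is_cone K"
    using K(1) by (simp add: nontrivial_cone_def)
  have zero: "\<psi> 0 = 0"
    by (rule sublinear_0[OF seminorm_sublinear[OF \<psi>]])
  have forward: assertion2
    if cpt: "compactin \<tau> (\<tau> closure_of neg_base_hull \<psi> K) \<or> compactin \<tau> (\<tau> closure_of base_hull0 \<psi> A)"
      and one: assertion1
  proof -
    obtain f \<alpha> where f: "f \<in> top_dual \<tau>" and \<alpha>: "\<alpha> > 0"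
      and fA: "\<And>a. a \<in> A - {0} \<Longrightarrow> f a + \<alpha> * \<psi> a > 0"
      and fK: "\<And>y. y \<in> K - {0} \<Longrightarrow> f y - \<alpha> * \<psi> y > 0"
      by (rule separating_pair_of_disjoint_closures[OF F \<psi> K A cpt[unfolded \<tau>]
            one[unfolded assertion1_def \<tau>], folded \<tau>]) blast
    have lin: "linear f"
      using f by (simp add: top_dual_def)
    have "f y > 0" if "y \<in> K - {0}" for y
    proof -
      have "\<alpha> * \<psi> y \<ge> 0"
        using \<alpha> seminorm_nonneg[OF \<psi>] by simp
      with fK[OF that] show ?thesis
        by linarith
    qed
    then have mem: "(f, \<alpha>) \<in> top_aug_dual_sharp \<tau> \<psi> K \<inter> (top_dual \<tau> \<times> {0<..})"
      using f \<alpha> fK lin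
      by (auto simp: top_aug_dual_sharp_def aug_dual_sharp_def dual_sharp_def alg_dual_def)
    have sA: "f a + \<alpha> * \<psi> a > 0" if "a \<in> A - {0}" for a
      by (rule fA[OF that])
    \<comment> \<open>The inequality on \<open>K\<close> is reflected to \<open>- K\<close>:
      \<open>f\<close> is odd and \<open>\<psi>\<close> is even.\<close>
    have sK: "f k + \<alpha> * \<psi> k < 0" if "k \<in> uminus ` K - {0}" for k
      using that fK[of "- k"] linear_neg[OF lin, of k] seminorm_minus[OF \<psi>, of k] by auto
    have "f 0 + \<alpha> * \<psi> 0 = 0"
      using zero lin by (simp add: linear_0)
    then have "f a + \<alpha> * \<psi> a \<ge> 0" if "a \<in> A" for a
      using that sA[of a] by (cases "a = 0") auto
    moreover have "f k + \<alpha> * \<psi> k \<le> 0" if "k \<in> uminus ` K" for k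
      using that sK[of k] \<open>f 0 + \<alpha> * \<psi> 0 = 0\<close> by (cases "k = 0") auto
    ultimately show assertion2
      unfolding assertion2_def using mem sA sK by blast
  qed
  have backward: assertion1
    if cpt: "compactin \<tau> (normlike_base \<psi> K)" and two: assertion2
  proof -
    obtain z where z: "z \<in> top_aug_dual_sharp \<tau> \<psi> K \<inter> (top_dual \<tau> \<times> {0<..})"
      "case z of (f, \<alpha>) \<Rightarrow>
        (\<forall>a\<in>A. \<forall>k\<in>uminus ` K. f a + \<alpha> * \<psi> a \<ge> 0 \<and> 0 \<ge> f k + \<alpha> * \<psi> k) \<and>
        (\<forall>a\<in>A - {0}. \<forall>k\<in>uminus ` K - {0}. f a + \<alpha> * \<psi> a > 0 \<and> 0 > f k + \<alpha> * \<psi> k)"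
      using two unfolding assertion2_def by (rule bexE)
    obtain f \<alpha> where zf: "z = (f, \<alpha>)"
      by (cases z)
    note mem = z(1)[unfolded zf] and ge = z(2)[unfolded zf prod.case, THEN conjunct1]
    \<comment> \<open>The inequalities are quantified jointly over \<open>a\<close> and
      \<open>k\<close>, so using the one for \<open>a\<close> requires some member of
      \<open>- K\<close>.\<close>
    have "0 \<in> uminus ` K"
      using cone by (force simp: is_cone_def)
    with ge have fA: "f a + \<alpha> \<ge> 0" if "a \<in> normlike_base \<psi> A" for a
      using that by (force simp: normlike_base_def)
    \<comment> \<open>This comes from the augmented dual cone; base elements are nonzero because
      \<open>\<psi> 0 = 0\<close>.\<close>
    have fK: "f y - \<alpha> > 0" if "y \<in> normlike_base \<psi> K" for y
      using that mem zero
      by (force simp: normlike_base_def top_aug_dual_sharp_def aug_dual_sharp_def)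
    show assertion1
      unfolding assertion1_def
      by (rule disjoint_closures_of_separating_pair[OF _ _ fA fK cpt normlike_base_nonempty[OF \<psi> K]])
        (use mem in auto)
  qed
  show ?thesis
    using forward backward compactin_normlike_base[OF F] unfolding \<tau> by blast
qed

end
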